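(* Let $n\ge1$ and let $\lambda$ be a partition. The sequence of dual stable Grothendieck polynomials $\{g_{k\lambda}(\mathbf{x})\}_{k=1}^\infty$ in the variables $\mathbf{x}=(x_1,\dots,x_n)$ satisfies a linear recurrence.
   Context: $k\lambda$ is obtained from $\lambda$ by multiplying every part by $k$. The dual stable Grothendieck polynomial in $n$ variables is $$g_\lambda(\mathbf{x})=\sum_{T\in\mathrm{RPP}(\lambda)}\mathbf{x}^{ev(T)},$$ where $\mathrm{RPP}(\lambda)$ is the set of reverse plane partitions of shape $\lambda$, i.e. fillings of the Young diagram of $\lambda$ with numbers in $\{1,\dots,n\}$ such that rows and columns are weakly decreasing, and $ev(T)=(ev(T)_1,\dots,ev(T)_n)$ with $ev(T)_i$ the total number of columns of $T$ in which $i$ appears. A sequence $\{a_k\}_{k\ge1}$ of polynomials satisfies a linear recurrence if there are $r\ge1$ and polynomials $c_1,\dots,c_r$ in the given variables, independent of $k$, such that $a_k+c_1a_{k-1}+\dots+c_ra_{k-r}=0$ for all $k\ge r+1$. *)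

theory Defs
  imports "HOL-Library.Poly_Mapping" "HOL-Library.FuncSet"
begin

(* A monomial is a finitely supported exponent vector nat =>0 nat, and a polynomial is a finitely
   supported map from monomials to coefficients; its product is the convolution product. *)
type_synonym 'a mpoly = "(nat \<Rightarrow>\<^sub>0 nat) \<Rightarrow>\<^sub>0 'a"

definition var :: "nat \<Rightarrow> 'a::comm_ring_1 mpoly" where
  "var i = Poly_Mapping.single (Poly_Mapping.single i 1) 1"

(* The polynomials in which only x_1, ..., x_n occur. *)
definition polys_in :: "nat \<Rightarrow> 'a::comm_ring_1 mpoly set" where
  "polys_in n = {p. \<forall>m\<in>Poly_Mapping.keys p. Poly_Mapping.keys m \<subseteq> {1..n}}"

(* A partition is the list of its (positive) parts; the empty partition is []. *)
definition is_partition :: "nat list \<Rightarrow> bool" where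
  "is_partition lam \<longleftrightarrow> sorted_wrt (\<ge>) lam \<and> (\<forall>p\<in>set lam. p > 0)"

definition scale_partition :: "nat \<Rightarrow> nat list \<Rightarrow> nat list" where
  "scale_partition k lam = map (\<lambda>p. k * p) lam"

(* The box (i, j) lies in row i and column j, both counted from 0. *)
definition young_diagram :: "nat list \<Rightarrow> (nat \<times> nat) set" where
  "young_diagram lam = {(i, j). i < length lam \<and> j < lam ! i}"

(* Fillings are extensional, i.e. fixed to be undefined outside the diagram, so that each filling
   is counted once. *)
definition RPP :: "nat \<Rightarrow> nat list \<Rightarrow> (nat \<times> nat \<Rightarrow> nat) set" where
  "RPP n lam = {T \<in> young_diagram lam \<rightarrow>\<^sub>E {1..n}.
     (\<forall>i j j'. (i, j) \<in> young_diagram lam \<and> (i, j') \<in> young_diagram lam \<and> j \<le> j'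
        \<longrightarrow> T (i, j) \<ge> T (i, j')) \<and>
     (\<forall>i i' j. (i, j) \<in> young_diagram lam \<and> (i', j) \<in> young_diagram lam \<and> i \<le> i'
        \<longrightarrow> T (i, j) \<ge> T (i', j))}"

definition ev :: "nat list \<Rightarrow> (nat \<times> nat \<Rightarrow> nat) \<Rightarrow> nat \<Rightarrow> nat" where
  "ev lam T v = card {j. \<exists>i. (i, j) \<in> young_diagram lam \<and> T (i, j) = v}"

definition dual_stable_grothendieck :: "nat \<Rightarrow> nat list \<Rightarrow> 'a::comm_ring_1 mpoly" where
  "dual_stable_grothendieck n lam = (\<Sum>T\<in>RPP n lam. \<Prod>i=1..n. var i ^ ev lam T i)"

(* Sequences are indexed by k >= 1, so the value a 0 is never used. *)
definition satisfies_linear_recurrence ::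
  "nat \<Rightarrow> (nat \<Rightarrow> 'a::comm_ring_1 mpoly) \<Rightarrow> bool" where
  "satisfies_linear_recurrence n a \<longleftrightarrow>
     (\<exists>r\<ge>1. \<exists>c. (\<forall>i\<in>{1..r}. c i \<in> polys_in n) \<and>
        (\<forall>k\<ge>r + 1. a k + (\<Sum>i=1..r. c i * a (k - i)) = 0))"

lemma finite_young_diagram: "finite (young_diagram lam)"
proof -
  have "young_diagram lam = (SIGMA i:{..<length lam}. {..<lam ! i})"
    by (auto simp: young_diagram_def)
  then show ?thesis by simp
qed

lemma finite_RPP: "finite (RPP n lam)"
  unfolding RPP_def
  by (rule finite_subset[OF _ finite_PiE[OF finite_young_diagram[of lam], of "\<lambda>_. {1..n}"]]) auto

end

theory Submission
  imports Defs
begin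

text \<open>
  Padding the columns of a reverse plane partition by zeros turns it into a descending chain of
  columns in a finite poset, and its monomial into the product of weights of the columns. Passing
  from \<open>\<lambda>\<close> to \<open>k\<lambda>\<close> repeats every column length \<open>k\<close> times, so \<open>g\<^sub>k\<^sub>\<lambda>\<close> is a sum of products of entries
  of \<open>k\<close>-th powers of transfer matrices, one for each column of \<open>\<lambda>\<close>. These matrices are triangular
  for the order on columns; hence each entry is annihilated by a product of operators \<open>E - w\<close>, with
  \<open>E\<close> the shift and \<open>w\<close> a weight. The sequences annihilated by such products form a ring.
\<close>

section \<open>Sequences with a split characteristic polynomial\<close>

text \<open>\<open>a\<close> is killed by a finite product of operators \<open>E - w\<close> with
  \<open>w \<in> S\<close>, where \<open>E\<close> is the shift. The inductive form gives induction
  on the number of factors.\<close>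

inductive split_recurrent :: "'r::comm_ring_1 set \<Rightarrow> (nat \<Rightarrow> 'r) \<Rightarrow> bool" for S where
  zero: "split_recurrent S (\<lambda>k. 0)"
| step: "w \<in> S \<Longrightarrow> split_recurrent S (\<lambda>k. a (Suc k) - w * a k) \<Longrightarrow> split_recurrent S a"

lemma split_recurrent_cmult:
  "split_recurrent S a \<Longrightarrow> split_recurrent S (\<lambda>k. x * a k)"
proof (induction rule: split_recurrent.induct)
  case zero
  then show ?case by (simp add: split_recurrent.zero)
next
  case (step w a)
  then show ?case by - (rule split_recurrent.step[of w]; (auto simp: algebra_simps))
qed

text \<open>Operators with constant coefficients commute, so the concatenated factors of both
  sequences kill the sum.\<close>

lemma split_recurrent_add:
  "split_recurrent S a \<Longrightarrow> split_recurrent S b \<Longrightarrow> split_recurrent S (\<lambda>k. a k + b k)"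
proof (induction arbitrary: b rule: split_recurrent.induct)
  case zero
  then show ?case by simp
next
  case (step w a)
  \<comment> \<open>Whatever kills \<open>b\<close> also kills \<open>(E - w) b\<close>.\<close>
  have "split_recurrent S (\<lambda>k. b (Suc k) - w * b k)"
    using step.prems
  proof (induction rule: split_recurrent.induct)
    case zero
    then show ?case by (simp add: split_recurrent.zero)
  next
    case (step v b)
    then show ?case by - (rule split_recurrent.step[of v]; (auto simp: algebra_simps))
  qed
  then have "split_recurrent S (\<lambda>k. (a (Suc k) - w * a k) + (b (Suc k) - w * b k))"
    by (rule step.IH)
  then show ?case
    using step.hyps by - (rule split_recurrent.step[of w]; (auto simp: algebra_simps))
qed

lemma split_recurrent_sum:
  "(\<And>x. x \<in> A \<Longrightarrow> split_recurrent S (f x)) \<Longrightarrow> split_recurrent S (\<lambda>k. \<Sum>x\<in>A. f x k)"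
  by (induction A rule: infinite_finite_induct)
     (auto intro: split_recurrent.zero split_recurrent_add)

text \<open>Nested induction on the factors of \<open>a\<close> and of \<open>b\<close>: applying
  \<open>E - w v\<close> to the product leaves terms in which at least one sequence has lost a
  factor.\<close>

lemma split_recurrent_mult:
  assumes S: "\<And>x y. x \<in> S \<Longrightarrow> y \<in> S \<Longrightarrow> x * y \<in> S"
  shows "split_recurrent S a \<Longrightarrow> split_recurrent S b \<Longrightarrow> split_recurrent S (\<lambda>k. a k * b k)"
proof (induction arbitrary: b rule: split_recurrent.induct)
  case zero
  then show ?case by (simp add: split_recurrent.zero)
next
  case (step w a)
  define a' where "a' = (\<lambda>k. a (Suc k) - w * a k)"
  have a': "split_recurrent S (\<lambda>k. a' k * b k)" if "split_recurrent S b" for b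
    using step.IH that by (simp add: a'_def)
  from step.prems show ?case
  proof (induction rule: split_recurrent.induct)
    case zero
    then show ?case by (simp add: split_recurrent.zero)
  next
    case (step v b)
    define b' where "b' = (\<lambda>k. b (Suc k) - v * b k)"
    have b: "split_recurrent S b" "split_recurrent S b'"
      using step.hyps split_recurrent.step[of v S b] by (simp_all add: b'_def)
    \<comment> \<open>\<open>(E - w v) (a b) = w a b' + v a' b + a' b'\<close> where \<open>a' = (E - w) a\<close> and \<open>b' = (E - v) b\<close>\<close>
    have "split_recurrent S (\<lambda>k. (w * (a k * b' k) + v * (a' k * b k)) + a' k * b' k)"
      using a' b step.IH
      by (intro split_recurrent_add split_recurrent_cmult) (simp_all add: b'_def)
    moreover have "(w * (a k * b' k) + v * (a' k * b k)) + a' k * b' k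
        = a (Suc k) * b (Suc k) - (w * v) * (a k * b k)" for k
      by (simp add: a'_def b'_def algebra_simps)
    ultimately show ?case
      using S[OF \<open>w \<in> S\<close> \<open>v \<in> S\<close>] by - (rule split_recurrent.step[of "w * v"]; auto)
  qed
qed

text \<open>Expanding the product of the \<open>E - w\<close> gives a monic polynomial in
  \<open>E\<close>; closure of \<open>S\<close> keeps its coefficients in \<open>S\<close>.\<close>

lemma split_recurrent_imp_monic_recurrence:
  assumes S: "0 \<in> S" "1 \<in> S" "\<And>x y. x \<in> S \<Longrightarrow> y \<in> S \<Longrightarrow> x - y \<in> S"
    "\<And>x y. x \<in> S \<Longrightarrow> y \<in> S \<Longrightarrow> x * y \<in> S"
  shows "split_recurrent S a \<Longrightarrow>
    \<exists>r\<ge>1. \<exists>d. d r = 1 \<and> (\<forall>i. d i \<in> S) \<and> (\<forall>k. (\<Sum>i\<le>r. d i * a (k + i)) = 0)"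
proof (induction rule: split_recurrent.induct)
  case zero
  \<comment> \<open>The empty product has order 0, but \<open>r \<ge> 1\<close> is demanded, so
    \<open>E + 1\<close> serves as annihilator of the zero sequence.\<close>
  show ?case using S by (intro exI[of _ 1] conjI exI[of _ "\<lambda>_. 1"]) auto
next
  case (step w a)
  then obtain r d where d: "r \<ge> 1" "d r = 1" "\<And>i. d i \<in> S"
    "\<And>k. (\<Sum>i\<le>r. d i * (a (Suc (k + i)) - w * a (k + i))) = 0"
    by auto
  \<comment> \<open>With \<open>P\<close> the operator with coefficients
    \<open>d 0, ..., d r\<close>, \<open>up\<close> and \<open>lo\<close> are the coefficients of
    \<open>E P\<close> and \<open>P\<close>, and \<open>e\<close> those of \<open>(E - w) P\<close>.
    The cutoff in \<open>lo\<close> is there because \<open>d\<close> is arbitrary beyond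
    \<open>r\<close>.\<close>
  define up where "up i = (if i = 0 then 0 else d (i - 1))" for i
  define lo where "lo i = (if i \<le> r then d i else 0)" for i
  define e where "e i = up i - w * lo i" for i
  have "(\<Sum>i\<le>Suc r. e i * a (k + i)) = 0" for k
  proof -
    have "(\<Sum>i\<le>Suc r. e i * a (k + i))
        = (\<Sum>i\<le>Suc r. up i * a (k + i)) - (\<Sum>i\<le>Suc r. w * lo i * a (k + i))"
      by (simp only: e_def left_diff_distrib sum_subtractf)
    also have "(\<Sum>i\<le>Suc r. up i * a (k + i)) = (\<Sum>i\<le>r. d i * a (Suc (k + i)))"
      by (subst sum.atMost_Suc_shift) (simp add: up_def)
    also have "(\<Sum>i\<le>Suc r. w * lo i * a (k + i)) = (\<Sum>i\<le>r. d i * (w * a (k + i)))"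
      by (simp add: lo_def algebra_simps)
    finally show ?thesis
      using d(4)[of k] by (simp add: right_diff_distrib sum_subtractf)
  qed
  moreover have "e (Suc r) = 1"
    using d by (simp add: e_def up_def lo_def)
  moreover have "e i \<in> S" for i
    using S d step.hyps by (simp add: e_def up_def lo_def)
  ultimately show ?case
    by (intro exI[of _ "Suc r"] conjI exI[of _ e]) auto
qed

section \<open>Weighted descending chains\<close>

primrec chain_sum :: "('c::order \<Rightarrow> 'r::comm_ring_1) \<Rightarrow> 'c set list \<Rightarrow> 'c \<Rightarrow> 'r" where
  "chain_sum w [] c = 1"
| "chain_sum w (B # Bs) c = (\<Sum>c'\<in>{c'\<in>B. c' \<le> c}. w c' * chain_sum w Bs c')"

definition descending_chains :: "'c::order set list \<Rightarrow> 'c \<Rightarrow> 'c list set" where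
  "descending_chains Bs c = {cs. list_all2 (\<in>) cs Bs \<and> sorted_wrt (\<ge>) (c # cs)}"

lemma descending_chains_Nil: "descending_chains [] c = {[]}"
  by (auto simp: descending_chains_def)

lemma descending_chains_Cons:
  "descending_chains (B # Bs) c =
     (\<lambda>(c', cs). c' # cs) ` (SIGMA c':{c'\<in>B. c' \<le> c}. descending_chains Bs c')"
proof -
  have "xs \<in> descending_chains (B # Bs) c \<longleftrightarrow>
      (\<exists>c' cs. xs = c' # cs \<and> c' \<in> B \<and> c' \<le> c \<and> cs \<in> descending_chains Bs c')" for xs
    by (cases xs) (auto simp: descending_chains_def intro: order_trans)
  then show ?thesis by (auto simp: image_iff)
qed

lemma finite_descending_chains: "(\<And>B. B \<in> set Bs \<Longrightarrow> finite B) \<Longrightarrow> finite (descending_chains Bs c)"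
  by (induction Bs arbitrary: c) (auto simp: descending_chains_Nil descending_chains_Cons)

text \<open>Links the recursive form, suited to transfer matrices, with the explicit sum that is
  matched with reverse plane partitions.\<close>

lemma chain_sum_eq_sum_descending_chains:
  "(\<And>B. B \<in> set Bs \<Longrightarrow> finite B) \<Longrightarrow>
     chain_sum w Bs c = (\<Sum>cs\<in>descending_chains Bs c. prod_list (map w cs))"
proof (induction Bs arbitrary: c)
  case Nil
  then show ?case by (simp add: descending_chains_Nil)
next
  case (Cons B Bs)
  have inj: "inj_on (\<lambda>(c', cs). c' # cs) X" for X :: "('a \<times> 'a list) set"
    by (auto simp: inj_on_def)
  have "(\<Sum>cs\<in>descending_chains (B # Bs) c. prod_list (map w cs))
      = (\<Sum>(c', cs)\<in>(SIGMA c':{c'\<in>B. c' \<le> c}. descending_chains Bs c'). w c' * prod_list (map w cs))"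
    unfolding descending_chains_Cons by (subst sum.reindex[OF inj]) (simp add: case_prod_unfold)
  also have "\<dots> = (\<Sum>c'\<in>{c'\<in>B. c' \<le> c}. \<Sum>cs\<in>descending_chains Bs c'. w c' * prod_list (map w cs))"
    using Cons.prems by (subst sum.Sigma) (auto intro: finite_descending_chains)
  finally show ?case
    using Cons by (simp add: sum_distrib_left)
qed

text \<open>Entry \<open>(c, b)\<close> of the \<open>k\<close>-th power of the matrix whose entry
  \<open>(c, c')\<close> is \<open>w c'\<close> if \<open>c' \<in> B\<close> and
  \<open>c' \<le> c\<close>, and 0 otherwise.\<close>

primrec transfer_power :: "('c::order \<Rightarrow> 'r::comm_ring_1) \<Rightarrow> 'c set \<Rightarrow> nat \<Rightarrow> 'c \<Rightarrow> 'c \<Rightarrow> 'r" where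
  "transfer_power w B 0 c b = (if c = b then 1 else 0)"
| "transfer_power w B (Suc k) c b = (\<Sum>c'\<in>{c'\<in>B. c' \<le> c}. w c' * transfer_power w B k c' b)"

text \<open>Chains are sorted by the element \<open>b\<close> reached after \<open>k\<close> steps.
  For \<open>k = 0\<close> this is \<open>c\<close> itself, which is why \<open>D\<close> must
  contain \<open>c\<close> as well as \<open>B\<close>.\<close>

lemma chain_sum_replicate:
  assumes "finite D" "B \<subseteq> D" "c \<in> D"
  shows "chain_sum w (replicate k B @ Bs) c = (\<Sum>b\<in>D. transfer_power w B k c b * chain_sum w Bs b)"
  using assms(3)
proof (induction k arbitrary: c)
  case 0
  have "(\<Sum>b\<in>D. transfer_power w B 0 c b * chain_sum w Bs b)
      = (\<Sum>b\<in>D. if c = b then chain_sum w Bs b else 0)"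
    by (intro sum.cong) auto
  then show ?case using 0 assms by simp
next
  case (Suc k)
  have "chain_sum w (replicate (Suc k) B @ Bs) c
      = (\<Sum>c'\<in>{c'\<in>B. c' \<le> c}. \<Sum>b\<in>D. w c' * transfer_power w B k c' b * chain_sum w Bs b)"
    using Suc assms(2) by (auto simp: sum_distrib_left mult.assoc intro!: sum.cong)
  also have "\<dots> = (\<Sum>b\<in>D. \<Sum>c'\<in>{c'\<in>B. c' \<le> c}. w c' * transfer_power w B k c' b * chain_sum w Bs b)"
    by (rule sum.swap)
  finally show ?case by (simp add: sum_distrib_right)
qed

text \<open>Triangularity: subtracting the diagonal term leaves only entries in rows
  \<open>c' < c\<close>, so induction on the number of elements of \<open>B\<close> below
  \<open>c\<close> applies.\<close>

lemma split_recurrent_transfer_power: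
  assumes B: "finite B" "\<And>c. c \<in> B \<Longrightarrow> w c \<in> S" and "0 \<in> S"
  shows "split_recurrent S (\<lambda>k. transfer_power w B k c b)"
proof (induction "card {c'\<in>B. c' < c}" arbitrary: c rule: less_induct)
  case less
  have below: "split_recurrent S (\<lambda>k. \<Sum>c'\<in>{c'\<in>B. c' < c}. w c' * transfer_power w B k c' b)"
  proof (intro split_recurrent_sum split_recurrent_cmult less)
    fix c' assume "c' \<in> {c'\<in>B. c' < c}"
    \<comment> \<open>The inclusion is strict because \<open>c'\<close> lies in the right-hand set
      only.\<close>
    then have "{d\<in>B. d < c'} \<subset> {c'\<in>B. c' < c}"
      by (auto intro: less_trans)
    then show "card {d\<in>B. d < c'} < card {c'\<in>B. c' < c}"
      using B by (intro psubset_card_mono) auto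
  qed
  show ?case
  proof (cases "c \<in> B")
    case True
    then have "{c'\<in>B. c' \<le> c} = insert c {c'\<in>B. c' < c}"
      by auto
    then have "transfer_power w B (Suc k) c b - w c * transfer_power w B k c b
        = (\<Sum>c'\<in>{c'\<in>B. c' < c}. w c' * transfer_power w B k c' b)" for k
      using B by simp
    then show ?thesis
      using below B True by - (rule split_recurrent.step[of "w c"]; (simp_all del: transfer_power.simps))
  next
    \<comment> \<open>Here the diagonal entry is 0, so the factor is \<open>E\<close>
      itself.\<close>
    case False
    then have "{c'\<in>B. c' \<le> c} = {c'\<in>B. c' < c}"
      by (auto simp: order_le_less)
    then have "transfer_power w B (Suc k) c b - 0 * transfer_power w B k c b
        = (\<Sum>c'\<in>{c'\<in>B. c' < c}. w c' * transfer_power w B k c' b)" for k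
      by simp
    then show ?thesis
      using below assms(3) by - (rule split_recurrent.step[of 0]; (simp_all del: transfer_power.simps))
  qed
qed

text \<open>Each block of \<open>k\<close> equal sets contributes an entry of a transfer power; sums
  and products of split recurrent sequences do the rest.\<close>

lemma split_recurrent_chain_sum:
  assumes S: "0 \<in> S" "1 \<in> S" "\<And>x y. x \<in> S \<Longrightarrow> y \<in> S \<Longrightarrow> x * y \<in> S"
    and D: "finite D" "\<And>c. c \<in> D \<Longrightarrow> w c \<in> S"
    and "\<And>B. B \<in> set Bs \<Longrightarrow> B \<subseteq> D" and "c \<in> D"
  shows "split_recurrent S (\<lambda>k. chain_sum w (concat (map (replicate k) Bs)) c)"
  using assms(6,7)
proof (induction Bs arbitrary: c)
  case Nil
  have "split_recurrent S (\<lambda>k. 1)"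
    by - (rule split_recurrent.step[of 1]; (simp_all add: S split_recurrent.zero))
  then show ?case by simp
next
  case (Cons B Bs)
  have B: "B \<subseteq> D" "finite B" using Cons.prems D by (auto intro: finite_subset)
  have "split_recurrent S (\<lambda>k. \<Sum>b\<in>D. transfer_power w B k c b *
      chain_sum w (concat (map (replicate k) Bs)) b)"
    using Cons B D S
    by (intro split_recurrent_sum split_recurrent_mult split_recurrent_transfer_power) auto
  then show ?case
    by (simp add: chain_sum_replicate[OF D(1) B(1) Cons.prems(2)])
qed

section \<open>Reverse plane partitions as chains of columns\<close>

text \<open>Padding by zeros makes columns of different heights comparable pointwise, with a missing
  box below every entry.\<close>

definition columns :: "nat \<Rightarrow> nat \<Rightarrow> (nat \<Rightarrow> nat) set" where
  "columns n h = {c. (\<forall>i<h. c i \<in> {1..n}) \<and> (\<forall>i\<ge>h. c i = 0) \<and> (\<forall>i i'. i \<le> i' \<and> i' < h \<longrightarrow> c i' \<le> c i)}"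

definition column_weight :: "nat \<Rightarrow> (nat \<Rightarrow> nat) \<Rightarrow> 'a::comm_ring_1 mpoly" where
  "column_weight n c = (\<Prod>v\<in>{v\<in>{1..n}. v \<in> range c}. var v)"

definition column_height :: "nat list \<Rightarrow> nat \<Rightarrow> nat" where
  "column_height mu j = card {i. (i, j) \<in> young_diagram mu}"

definition column_of :: "nat list \<Rightarrow> (nat \<times> nat \<Rightarrow> nat) \<Rightarrow> nat \<Rightarrow> nat \<Rightarrow> nat" where
  "column_of mu T j i = (if (i, j) \<in> young_diagram mu then T (i, j) else 0)"

lemma finite_columns: "finite (columns n h)"
proof (rule finite_subset)
  show "finite {c. \<forall>i. (i \<in> {..<h} \<longrightarrow> c i \<in> {1..n}) \<and> (i \<notin> {..<h} \<longrightarrow> c i = 0)}"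
    by (rule finite_set_of_finite_funs) auto
qed (auto simp: columns_def)

text \<open>The rows weakly shorten downwards, so the boxes of a column form an initial
  segment.\<close>

lemma young_diagram_iff_height:
  assumes "sorted_wrt (\<ge>) mu"
  shows "(i, j) \<in> young_diagram mu \<longleftrightarrow> i < column_height mu j"
proof -
  let ?A = "{i. (i, j) \<in> young_diagram mu}"
  have fin: "finite ?A"
    by (rule finite_subset[of _ "{..<length mu}"]) (auto simp: young_diagram_def)
  have down: "i \<in> ?A" if "i' \<in> ?A" "i \<le> i'" for i i'
  proof (cases "i = i'")
    case False
    then have "mu ! i' \<le> mu ! i"
      using that sorted_wrt_nth_less[OF assms, of i i'] by (simp add: young_diagram_def)
    then show ?thesis using that by (simp add: young_diagram_def)
  qed (use that in simp)
  show ?thesis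
  proof
    assume "(i, j) \<in> young_diagram mu"
    then have "{..i} \<subseteq> ?A" using down by auto
    from card_mono[OF fin this] show "i < column_height mu j"
      by (simp add: column_height_def)
  next
    assume *: "i < column_height mu j"
    show "(i, j) \<in> young_diagram mu"
    proof (rule ccontr)
      assume "(i, j) \<notin> young_diagram mu"
      then have "?A \<subseteq> {..<i}" using down by (metis mem_Collect_eq lessThan_iff not_le subsetI)
      from card_mono[OF _ this] * show False by (simp add: column_height_def)
    qed
  qed
qed

text \<open>Exchanging the products over columns and over values collects one factor
  \<open>var v\<close> for each column containing \<open>v\<close>.\<close>

lemma prod_list_column_weight:
  assumes T: "T \<in> RPP n mu" and N: "\<And>p. p \<in> set mu \<Longrightarrow> p \<le> N"
  shows "prod_list (map (column_weight n) (map (column_of mu T) [0..<N]))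
    = (\<Prod>v=1..n. var v ^ ev mu T v :: 'a::comm_ring_1 mpoly)"
proof -
  have col: "v \<in> range (column_of mu T j) \<longleftrightarrow> (\<exists>i. (i, j) \<in> young_diagram mu \<and> T (i, j) = v)"
    if "v \<ge> 1" for v j
    using that by (auto simp: column_of_def image_iff)
  have bound: "j < N" if "(i, j) \<in> young_diagram mu" for i j
    using that N[OF nth_mem[of i mu]] by (simp add: young_diagram_def)
  have "prod_list (map (column_weight n) (map (column_of mu T) [0..<N]))
      = (\<Prod>j<N. column_weight n (column_of mu T j) :: 'a mpoly)"
    by (simp add: prod.distinct_set_conv_list[symmetric] lessThan_atLeast0)
  also have "\<dots> = (\<Prod>j<N. \<Prod>v=1..n. if v \<in> range (column_of mu T j) then var v else 1)"
    unfolding column_weight_def by (intro prod.cong refl prod.inter_filter) simp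
  also have "\<dots> = (\<Prod>v=1..n. \<Prod>j<N. if v \<in> range (column_of mu T j) then var v else 1)"
    by (rule prod.swap)
  also have "\<dots> = (\<Prod>v=1..n. var v ^ ev mu T v)"
  proof (rule prod.cong[OF refl])
    fix v assume "v \<in> {1..n}"
    then have "{j\<in>{..<N}. v \<in> range (column_of mu T j)}
        = {j. \<exists>i. (i, j) \<in> young_diagram mu \<and> T (i, j) = v}"
      using col[of v] bound by auto
    then show "(\<Prod>j<N. if v \<in> range (column_of mu T j) then var v else 1) = (var v ^ ev mu T v :: 'a mpoly)"
      by (simp add: prod.inter_filter[symmetric] ev_def)
  qed
  finally show ?thesis .
qed

text \<open>
  \<open>N\<close> may exceed the number of columns: the surplus columns are zero and have weight \<open>1\<close>.
\<close>
lemma dual_stable_grothendieck_eq_chain_sum: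
  assumes mu: "sorted_wrt (\<ge>) mu" and N: "\<And>p. p \<in> set mu \<Longrightarrow> p \<le> N"
  shows "(dual_stable_grothendieck n mu :: 'a::comm_ring_1 mpoly)
    = chain_sum (column_weight n) (map (\<lambda>j. columns n (column_height mu j)) [0..<N]) (\<lambda>_. n)"
proof -
  let ?Bs = "map (\<lambda>j. columns n (column_height mu j)) [0..<N]"
  let ?Y = "young_diagram mu"
  have Y: "(i, j) \<in> ?Y \<longleftrightarrow> i < column_height mu j" for i j
    by (rule young_diagram_iff_height[OF mu])
  have bound: "j < N" if "(i, j) \<in> ?Y" for i j
    using that N[OF nth_mem[of i mu]] by (simp add: young_diagram_def)
  have left: "(i, j) \<in> ?Y" if "(i, j') \<in> ?Y" "j \<le> j'" for i j j'
    using that by (auto simp: young_diagram_def)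
  have chains_iff: "cs \<in> descending_chains ?Bs (\<lambda>_. n) \<longleftrightarrow>
      length cs = N \<and> (\<forall>j<N. cs ! j \<in> columns n (column_height mu j)) \<and>
      (\<forall>j j'. j < j' \<and> j' < N \<longrightarrow> cs ! j' \<le> cs ! j)" for cs
  proof -
    \<comment> \<open>The starting bound lies above every column, so it imposes no condition on a
      chain.\<close>
    have "c \<le> (\<lambda>_. n)" if "c \<in> columns n h" for c h
      unfolding le_fun_def
    proof
      fix i show "c i \<le> n" using that by (cases "i < h") (auto simp: columns_def)
    qed
    then show ?thesis
      unfolding descending_chains_def sorted_wrt.simps
      by (auto simp: list_all2_conv_all_nth sorted_wrt_iff_nth_less all_set_conv_all_nth)
  qed
  have "(\<Sum>T\<in>RPP n mu. \<Prod>v=1..n. var v ^ ev mu T v)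
      = (\<Sum>cs\<in>descending_chains ?Bs (\<lambda>_. n). prod_list (map (column_weight n) cs) :: 'a mpoly)"
  \<comment> \<open>A filling goes to its list of padded columns; the inverse reads off the entries,
    and \<open>restrict\<close> makes the result extensional.\<close>
  proof (rule sum.reindex_bij_witness[where
      i = "\<lambda>cs. restrict (\<lambda>(i, j). (cs ! j) i) ?Y" and
      j = "\<lambda>T. map (column_of mu T) [0..<N]"])
    fix T assume T: "T \<in> RPP n mu"
    then have TE: "T \<in> ?Y \<rightarrow>\<^sub>E {1..n}"
      by (simp add: RPP_def)
    show "restrict (\<lambda>(i, j). (map (column_of mu T) [0..<N] ! j) i) ?Y = T"
    proof
      fix x show "restrict (\<lambda>(i, j). (map (column_of mu T) [0..<N] ! j) i) ?Y x = T x"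
      proof (cases "x \<in> ?Y")
        case True
        then show ?thesis using bound[of "fst x" "snd x"] by (cases x) (simp add: column_of_def)
      qed (simp add: PiE_arb[OF TE])
    qed
    have "column_of mu T j \<in> columns n (column_height mu j)" for j
      using T by (auto simp: columns_def column_of_def Y RPP_def PiE_iff)
    \<comment> \<open>If \<open>(i, j')\<close> is a box then so is \<open>(i, j)\<close>, and the
      row condition applies; otherwise the left side is 0.\<close>
    moreover have "column_of mu T j' \<le> column_of mu T j" if "j < j'" for j j'
      using T that left[of _ j' j] by (auto simp: le_fun_def column_of_def RPP_def)
    ultimately show "map (column_of mu T) [0..<N] \<in> descending_chains ?Bs (\<lambda>_. n)"
      by (auto simp: chains_iff)
    show "prod_list (map (column_weight n) (map (column_of mu T) [0..<N]))
        = (\<Prod>v=1..n. var v ^ ev mu T v :: 'a mpoly)"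
      using T N by (rule prod_list_column_weight)
  next
    fix cs assume "cs \<in> descending_chains ?Bs (\<lambda>_. n)"
    then have len: "length cs = N"
      and col: "\<And>j. j < N \<Longrightarrow> cs ! j \<in> columns n (column_height mu j)"
      and desc: "\<And>j j'. j < j' \<Longrightarrow> j' < N \<Longrightarrow> cs ! j' \<le> cs ! j"
      by (auto simp: chains_iff)
    let ?T = "restrict (\<lambda>(i, j). (cs ! j) i) ?Y"
    show "map (column_of mu ?T) [0..<N] = cs"
      using len col by (auto intro!: nth_equalityI ext simp: column_of_def columns_def Y)
    have "(cs ! j') i \<le> (cs ! j) i" if "(i, j') \<in> ?Y" "j \<le> j'" for i j j'
      using desc[of j j'] that bound by (cases "j = j'") (auto simp: le_fun_def)
    moreover have "(cs ! j) i' \<le> (cs ! j) i" if "(i', j) \<in> ?Y" "i \<le> i'" for i i' j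
      using col[of j] that bound by (auto simp: columns_def Y)
    moreover have "(cs ! j) i \<in> {1..n}" if "(i, j) \<in> ?Y" for i j
      using col[of j] that bound by (auto simp: columns_def Y)
    ultimately show "?T \<in> RPP n mu"
      unfolding RPP_def by (auto simp: PiE_iff)
  qed
  also have "\<dots> = chain_sum (column_weight n) ?Bs (\<lambda>_. n)"
    by (subst chain_sum_eq_sum_descending_chains) (auto simp: finite_columns)
  finally show ?thesis by (simp add: dual_stable_grothendieck_def)
qed

lemma column_height_scale_partition:
  assumes "k > 0"
  shows "column_height (scale_partition k lam) j = column_height lam (j div k)"
proof -
  have "(i, j) \<in> young_diagram (scale_partition k lam) \<longleftrightarrow> (i, j div k) \<in> young_diagram lam" for i
    using div_less_iff_less_mult[OF assms, of j "lam ! i"]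
    by (auto simp: young_diagram_def scale_partition_def mult.commute)
  then show ?thesis by (simp add: column_height_def)
qed

lemma map_div_upt:
  assumes "k > 0"
  shows "map (\<lambda>j. f (j div k)) [0..<k * L] = concat (map (replicate k) (map f [0..<L]))"
proof (induction L)
  case (Suc L)
  have "map (\<lambda>j. f (j div k)) [k * L..<k * L + k] = replicate k (f L)"
    using assms by (intro nth_equalityI) auto
  moreover have "[0..<k * Suc L] = [0..<k * L] @ [k * L..<k * L + k]"
    using upt_add_eq_append[of 0 "k * L" k] by (simp add: add.commute)
  ultimately show ?case using Suc by simp
qed simp

text \<open>The list of column sets is the same for all \<open>k\<close>; only the repetition
  varies. \<open>sum_list lam\<close> bounds every part and also covers the empty partition.\<close>

lemma dual_stable_grothendieck_scale:
  assumes "is_partition lam" "k > 0"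
  shows "(dual_stable_grothendieck n (scale_partition k lam) :: 'a::comm_ring_1 mpoly)
    = chain_sum (column_weight n) (concat (map (replicate k)
        (map (\<lambda>q. columns n (column_height lam q)) [0..<sum_list lam]))) (\<lambda>_. n)"
proof -
  have "sorted_wrt (\<ge>) (scale_partition k lam)"
    using assms(1) by (auto simp: is_partition_def scale_partition_def sorted_wrt_map
      intro: sorted_wrt_mono_rel[rotated])
  moreover have "p \<le> k * sum_list lam" if "p \<in> set (scale_partition k lam)" for p
    using that by (auto simp: scale_partition_def intro: member_le_sum_list)
  ultimately show ?thesis
    by (subst dual_stable_grothendieck_eq_chain_sum[where N = "k * sum_list lam"])
       (simp_all only: column_height_scale_partition[OF assms(2)] map_div_upt[OF assms(2), of "\<lambda>q. columns n (column_height lam q)"])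
qed

section \<open>The recurrence\<close>

lemma polys_in_0: "0 \<in> polys_in n"
  by (simp add: polys_in_def)

lemma polys_in_1: "1 \<in> polys_in n"
  by (auto simp: polys_in_def)

lemma polys_in_diff: "p \<in> polys_in n \<Longrightarrow> q \<in> polys_in n \<Longrightarrow> p - q \<in> polys_in n"
  using keys_diff[of p q] by (fastforce simp: polys_in_def)

lemma polys_in_mult:
  assumes "p \<in> polys_in n" "q \<in> polys_in n"
  shows "p * q \<in> polys_in n"
  unfolding polys_in_def
proof (intro CollectI ballI)
  fix m assume "m \<in> Poly_Mapping.keys (p * q)"
  then obtain a b where "m = a + b" "a \<in> Poly_Mapping.keys p" "b \<in> Poly_Mapping.keys q"
    using keys_mult[of p q] by blast
  then show "Poly_Mapping.keys m \<subseteq> {1..n}"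
    using assms Poly_Mapping.keys_add[of a b] by (fastforce simp: polys_in_def)
qed

lemma polys_in_var: "i \<in> {1..n} \<Longrightarrow> var i \<in> polys_in n"
  by (auto simp: polys_in_def var_def)

lemma column_weight_in_polys_in: "column_weight n c \<in> polys_in n"
proof -
  have *: "(\<Prod>v\<in>A. var v) \<in> polys_in n" if "A \<subseteq> {1..n}" for A
    using that
    by (induction A rule: infinite_finite_induct)
       (auto intro!: polys_in_1 polys_in_mult polys_in_var simp del: atLeastAtMost_iff)
  show ?thesis unfolding column_weight_def by (rule *) auto
qed

theorem mainTheorem5:
  fixes n :: nat and lam :: "nat list"
  assumes "n \<ge> 1" and "is_partition lam"
  shows "satisfies_linear_recurrence n
    (\<lambda>k. dual_stable_grothendieck n (scale_partition k lam) :: 'a::comm_ring_1 mpoly)"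
proof -
  define g :: "nat \<Rightarrow> 'a mpoly"
    where "g k = dual_stable_grothendieck n (scale_partition k lam)" for k
  define Bs where "Bs = map (\<lambda>q. columns n (column_height lam q)) [0..<sum_list lam]"
  define a :: "nat \<Rightarrow> 'a mpoly"
    where "a k = chain_sum (column_weight n) (concat (map (replicate k) Bs)) (\<lambda>_. n)" for k
  have g: "g k = a k" if "k > 0" for k
    unfolding g_def a_def Bs_def using assms(2) that by (rule dual_stable_grothendieck_scale)
  have "split_recurrent (polys_in n) a"
    unfolding a_def
    \<comment> \<open>All occurring columns, together with the starting bound, which is not itself a
      padded column.\<close>
    by (rule split_recurrent_chain_sum[where D = "insert (\<lambda>_. n) (\<Union>(set Bs))"])
       (auto simp: Bs_def finite_columns
         intro: polys_in_0 polys_in_1 polys_in_mult column_weight_in_polys_in)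
  from split_recurrent_imp_monic_recurrence[OF polys_in_0 polys_in_1 polys_in_diff polys_in_mult this]
  obtain r d where d: "r \<ge> 1" "d r = 1" "\<And>i. d i \<in> polys_in n"
    "\<And>k. (\<Sum>i\<le>r. d i * a (k + i)) = 0"
    by blast
  \<comment> \<open>The monic relation at \<open>k - r\<close>, read backwards:
    \<open>d r = 1\<close> gives the term \<open>g k\<close>. All indices are at least 1, where
    \<open>g\<close> and \<open>a\<close> agree.\<close>
  have "g k + (\<Sum>i=1..r. d (r - i) * g (k - i)) = 0" if "k \<ge> r + 1" for k
  proof -
    have "(\<Sum>i=1..r. d (r - i) * g (k - i)) = (\<Sum>i<r. d i * a (k - r + i))"
      using that
      by (intro sum.reindex_bij_witness[where i = "\<lambda>i. r - i" and j = "\<lambda>i. r - i"]) (auto simp: g)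
    moreover have "(\<Sum>i\<le>r. d i * a (k - r + i)) = (\<Sum>i<r. d i * a (k - r + i)) + g k"
      using that d(2) by (simp add: lessThan_Suc_atMost[symmetric] g)
    ultimately show ?thesis
      using d(4)[of "k - r"] by (simp add: add.commute)
  qed
  then show ?thesis
    unfolding satisfies_linear_recurrence_def g_def using d(1,3)
    by (intro exI[of _ r] conjI exI[of _ "\<lambda>i. d (r - i)"]) auto
qed

end
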